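(* Let $\nu>0$, let $\chi_\omega\in L^\infty(\mathbb{T}^3)$ be nonnegative and let $K_{\min}\ge 0$. Define $$\alpha_\omega(K_{\min}):=\inf_{v\in V\setminus\{0\}}\frac{\nu\|\nabla v\|_{L^2(\mathbb{T}^3)}^2+K_{\min}\|\chi_\omega^{1/2}v\|_{L^2(\mathbb{T}^3)}^2}{\|v\|_{L^2(\mathbb{T}^3)}^2}.$$ Then, for all $v\in V$, $$\nu\|\nabla v\|_{L^2(\mathbb{T}^3)}^2+K_{\min}\|\chi_\omega^{1/2}v\|_{L^2(\mathbb{T}^3)}^2\ge\alpha_\omega(K_{\min})\|v\|_{L^2(\mathbb{T}^3)}^2.$$ Moreover, $\alpha_\omega(K_{\min})>0$ if and only if there exists a constant $\alpha>0$ such that $$\nu\|\nabla v\|_{L^2(\mathbb{T}^3)}^2+K_{\min}\|\chi_\omega^{1/2}v\|_{L^2(\mathbb{T}^3)}^2\ge\alpha\|v\|_{L^2(\mathbb{T}^3)}^2\qquad\text{for all } v\in V,$$ and in that case $\alpha_\omega(K_{\min})$ is the largest constant $\alpha$ for which this inequality holds.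
   Context: $\mathbb{T}^3=(\mathbb{R}/\mathbb{Z})^3$. $H:=\{v\in L^2(\mathbb{T}^3;\mathbb{R}^3): \nabla\cdot v=0,\ \int_{\mathbb{T}^3}v\,dx=0\}$ with the $L^2$ norm, and $V:=H^1(\mathbb{T}^3;\mathbb{R}^3)\cap H$. *)

theory Defs
  imports "HOL-Analysis.Analysis"
begin

section \<open>Function spaces on the flat torus\<close>

text \<open>
  Functions on \<open>(\<real>/\<int>)\<^sup>3\<close> are represented by \<open>\<int>\<^sup>3\<close>-periodic functions on \<open>\<real>\<^sup>3\<close>, and integrals over the
  torus by Lebesgue integrals over the unit cube.  Elements of \<open>L\<^sup>2\<close> and of \<open>L\<^sup>\<infinity>\<close> are represented by
  functions, not by equivalence classes; hence "nonzero" means "not almost everywhere zero".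
\<close>

definition periodic :: "(real^3 \<Rightarrow> 'a) \<Rightarrow> bool" where
  "periodic f \<longleftrightarrow> (\<forall>x k. (\<forall>i. k $ i \<in> \<int>) \<longrightarrow> f (x + k) = f x)"

definition torus :: "(real^3) measure" where
  "torus = lebesgue_on (cbox 0 1)"

definition L2 :: "(real^3 \<Rightarrow> 'a::euclidean_space) set" where
  "L2 = {f. periodic f \<and> f \<in> borel_measurable torus \<and> integrable torus (\<lambda>x. (norm (f x))\<^sup>2)}"

definition L2_norm :: "(real^3 \<Rightarrow> 'a::euclidean_space) \<Rightarrow> real" where
  "L2_norm f = sqrt (\<integral>x. (norm (f x))\<^sup>2 \<partial>torus)"

definition Linfty :: "(real^3 \<Rightarrow> real) set" where
  "Linfty = {f. periodic f \<and> f \<in> borel_measurable torus \<and> (\<exists>C. AE x in torus. \<bar>f x\<bar> \<le> C)}"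

definition partial :: "3 \<Rightarrow> (real^3 \<Rightarrow> real) \<Rightarrow> real^3 \<Rightarrow> real" where
  "partial j \<phi> x = frechet_derivative \<phi> (at x) (axis j 1)"

primrec Ck :: "nat \<Rightarrow> (real^3 \<Rightarrow> real) \<Rightarrow> bool" where
  "Ck 0 f \<longleftrightarrow> continuous_on UNIV f"
| "Ck (Suc k) f \<longleftrightarrow> (\<forall>x. f differentiable (at x)) \<and> (\<forall>j. Ck k (partial j f))"

definition test_functions :: "(real^3 \<Rightarrow> real) set" where
  "test_functions = {\<phi>. periodic \<phi> \<and> (\<forall>k. Ck k \<phi>)}"

text \<open>The entry \<open>g x $ i $ j\<close> is the weak derivative of the \<open>i\<close>-th component in direction \<open>j\<close>.\<close>

definition has_weak_gradient :: "(real^3 \<Rightarrow> real^3) \<Rightarrow> (real^3 \<Rightarrow> real^3^3) \<Rightarrow> bool" where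
  "has_weak_gradient v g \<longleftrightarrow> (\<forall>\<phi>\<in>test_functions. \<forall>i j.
     (\<integral>x. v x $ i * partial j \<phi> x \<partial>torus) = - (\<integral>x. g x $ i $ j * \<phi> x \<partial>torus))"

definition H1 :: "(real^3 \<Rightarrow> real^3) set" where
  "H1 = {v \<in> L2. \<exists>g\<in>L2. has_weak_gradient v g}"

text \<open>
  The weak gradient is unique up to null sets, so the choice below does not affect integrals of it.
  The norm on \<^typ>\<open>real^3^3\<close> is the Frobenius norm, so \<open>L2_norm (weak_gradient v)\<close> is the usual
  \<open>L\<^sup>2\<close> norm of the gradient.
\<close>

definition weak_gradient :: "(real^3 \<Rightarrow> real^3) \<Rightarrow> real^3 \<Rightarrow> real^3^3" where
  "weak_gradient v = (SOME g. g \<in> L2 \<and> has_weak_gradient v g)"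

text \<open>Vanishing divergence in the sense of distributions.\<close>

definition divergence_free :: "(real^3 \<Rightarrow> real^3) \<Rightarrow> bool" where
  "divergence_free v \<longleftrightarrow>
     (\<forall>\<phi>\<in>test_functions. (\<integral>x. (\<Sum>j\<in>UNIV. v x $ j * partial j \<phi> x) \<partial>torus) = 0)"

definition H_space :: "(real^3 \<Rightarrow> real^3) set" where
  "H_space = {v \<in> L2. divergence_free v \<and> (\<integral>x. v x \<partial>torus) = 0}"

definition V_space :: "(real^3 \<Rightarrow> real^3) set" where
  "V_space = H1 \<inter> H_space"

definition energy :: "real \<Rightarrow> (real^3 \<Rightarrow> real) \<Rightarrow> real \<Rightarrow> (real^3 \<Rightarrow> real^3) \<Rightarrow> real" where
  "energy \<nu> \<chi>\<^sub>\<omega> K v =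
     \<nu> * (L2_norm (weak_gradient v))\<^sup>2 + K * (L2_norm (\<lambda>x. sqrt (\<chi>\<^sub>\<omega> x) *\<^sub>R v x))\<^sup>2"

definition alpha :: "real \<Rightarrow> (real^3 \<Rightarrow> real) \<Rightarrow> real \<Rightarrow> real" where
  "alpha \<nu> \<chi>\<^sub>\<omega> K =
     (INF v \<in> {v \<in> V_space. \<not> (AE x in torus. v x = 0)}. energy \<nu> \<chi>\<^sub>\<omega> K v / (L2_norm v)\<^sup>2)"

end

theory Submission imports Defs begin

text \<open>
  The energy is nonnegative, so the Rayleigh quotients are bounded below by \<open>0\<close> and \<open>alpha\<close> is their
  greatest lower bound, provided there is at least one quotient: the infimum of the empty set of reals
  is a junk value.  The shear flow \<open>(sin (2 \<pi> x\<^sub>2), 0, 0)\<close> is a nonzero element of \<open>V_space\<close>.  Its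
  classical derivatives are weak derivatives because the integral over a unit cube of a periodic
  function is invariant under translation, so that integrals of partial derivatives vanish.
\<close>

section \<open>Integrals of periodic functions over the unit cube\<close>

lemma periodicD_axis:
  assumes "periodic f"
  shows "f (x + axis j 1) = f x"
  using assms unfolding periodic_def by (auto simp: axis_def)

text \<open>The shifted cube sticks out of the unit cube by a slab of thickness \<open>h\<close>;
  moved back by one period, this slab fills exactly the gap left on the opposite side.\<close>

lemma integral_periodic_translate:
  fixes f :: "real^3 \<Rightarrow> real"
  assumes per: "periodic f" and cont: "continuous_on UNIV f" and h: "0 \<le> h" "h \<le> 1"
  shows "integral (cbox 0 1) (\<lambda>x. f (x + h *\<^sub>R axis j 1)) = integral (cbox 0 1) f"
proof -
  let ?e = "axis j 1 :: real^3"
  have int: "f integrable_on cbox a b" for a b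
    using cont continuous_on_subset integrable_continuous subset_UNIV by blast
  have e: "?e \<in> Basis" by (simp add: axis_in_Basis_iff)
  have comp: "x \<bullet> ?e = x $ j" for x by (simp add: inner_axis)
  have mem: "x \<in> cbox a b \<longleftrightarrow>
      a $ j \<le> x $ j \<and> x $ j \<le> b $ j \<and> (\<forall>i. i \<noteq> j \<longrightarrow> a $ i \<le> x $ i \<and> x $ i \<le> b $ i)"
    for a b x :: "real^3"
    unfolding mem_box_cart by metis
  \<comment> \<open>The shifted cube is cut at height 1 and the unit cube at height \<open>h\<close>
    in direction \<open>j\<close>. The two share the box \<open>cbox (h *\<^sub>R ?e) 1\<close>, and
    the remaining slabs differ by the translation \<open>?e\<close>.\<close>
  have sets:
    "cbox (h *\<^sub>R ?e) (1 + h *\<^sub>R ?e) \<inter> {x. x \<bullet> ?e \<le> 1} = cbox (h *\<^sub>R ?e) 1"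
    "cbox (h *\<^sub>R ?e) (1 + h *\<^sub>R ?e) \<inter> {x. x \<bullet> ?e \<ge> 1} = cbox ?e (1 + h *\<^sub>R ?e)"
    "cbox 0 1 \<inter> {x. x \<bullet> ?e \<le> h} = cbox 0 (1 + h *\<^sub>R ?e - ?e)"
    "cbox 0 1 \<inter> {x. x \<bullet> ?e \<ge> h} = cbox (h *\<^sub>R ?e) 1"
    using h unfolding comp by (auto simp: mem axis_def)
  have "integral (cbox 0 1) (\<lambda>x. f (x + h *\<^sub>R ?e)) = integral (cbox (h *\<^sub>R ?e) (1 + h *\<^sub>R ?e)) f"
    using integral_shift_cbox[of "h *\<^sub>R ?e" "h *\<^sub>R ?e" "1 + h *\<^sub>R ?e" f] by simp
  also have "\<dots> = integral (cbox (h *\<^sub>R ?e) 1) f + integral (cbox ?e (1 + h *\<^sub>R ?e)) f"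
    using integral_split[OF int e, of "h *\<^sub>R ?e" "1 + h *\<^sub>R ?e" 1] by (simp only: sets)
  also have "integral (cbox ?e (1 + h *\<^sub>R ?e)) f = integral (cbox 0 (1 + h *\<^sub>R ?e - ?e)) f"
    using integral_shift_cbox[of ?e ?e "1 + h *\<^sub>R ?e" f] by (simp add: periodicD_axis[OF per])
  also have "integral (cbox (h *\<^sub>R ?e) 1) f + \<dots> = integral (cbox 0 1) f"
    using integral_split[OF int e, of 0 1 h] by (simp only: sets add.commute)
  finally show ?thesis .
qed

lemma integrable_torus_continuous:
  fixes f :: "real^3 \<Rightarrow> 'a::euclidean_space"
  assumes "continuous_on UNIV f"
  shows "integrable torus f"
  unfolding torus_def
  by (intro absolutely_integrable_imp_integrable absolutely_integrable_continuous
      continuous_on_subset[OF assms]) auto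

text \<open>Bridge from the Bochner integral of the definitions to the gauge integral, where boxes
  are translated and split and the Leibniz rule is applied.\<close>

lemma lebesgue_integral_torus_eq_integral:
  fixes f :: "real^3 \<Rightarrow> 'a::euclidean_space"
  assumes "continuous_on UNIV f"
  shows "(\<integral>x. f x \<partial>torus) = integral (cbox 0 1) f"
  using integrable_torus_continuous[OF assms] unfolding torus_def
  by (intro lebesgue_integral_eq_integral) auto

lemma partial_eqI: "(f has_derivative f') (at x) \<Longrightarrow> partial j f x = f' (axis j 1)"
  unfolding partial_def using frechet_derivative_at by metis

lemma differentiable_imp_continuous_on_UNIV:
  "(\<And>x. f differentiable (at x)) \<Longrightarrow> continuous_on UNIV f"
  by (simp add: continuous_at_imp_continuous_on differentiable_imp_continuous_within)

text \<open>Chain rule along a coordinate line. The set \<open>S\<close> is kept general because the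
  Leibniz rule below is used on the parameter interval \<open>{0..1}\<close>.\<close>

lemma has_real_derivative_along_axis:
  assumes "f differentiable (at (x + t *\<^sub>R axis j 1))"
  shows "((\<lambda>t. f (x + t *\<^sub>R axis j 1)) has_real_derivative partial j f (x + t *\<^sub>R axis j 1)) (at t within S)"
proof -
  let ?y = "x + t *\<^sub>R axis j 1" and ?D = "frechet_derivative f (at (x + t *\<^sub>R axis j 1))"
  have D: "(f has_derivative ?D) (at ?y)"
    using assms frechet_derivative_works by blast
  have "((\<lambda>t. x + t *\<^sub>R axis j 1) has_derivative (\<lambda>s. s *\<^sub>R axis j 1)) (at t within S)"
    by (auto intro!: derivative_eq_intros)
  from has_derivative_compose[OF this D]
  have "((\<lambda>t. f (x + t *\<^sub>R axis j 1)) has_derivative (\<lambda>s. ?D (s *\<^sub>R axis j 1))) (at t within S)" .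
  moreover have "?D (s *\<^sub>R axis j 1) = partial j f ?y * s" for s
    using linear_scale[OF has_derivative_linear[OF D]] by (simp add: partial_def)
  ultimately show ?thesis
    unfolding has_field_derivative_def by simp
qed

text \<open>The integral of the translate by \<open>t\<close> along the axis is constant in
  \<open>t\<close>, and its derivative at 0, taken under the integral sign, is the integral of the
  partial derivative.\<close>

lemma integral_partial_eq_0:
  assumes per: "periodic f" and diff: "\<And>x. f differentiable (at x)"
    and cont: "continuous_on UNIV (partial j f)"
  shows "(\<integral>x. partial j f x \<partial>torus) = 0"
proof -
  let ?I = "\<lambda>t. integral (cbox 0 1) (\<lambda>x. f (x + t *\<^sub>R axis j 1))"
  have cf: "continuous_on UNIV f"
    using diff by (rule differentiable_imp_continuous_on_UNIV)
  have "(?I has_real_derivative integral (cbox 0 1) (\<lambda>x. partial j f (x + 0 *\<^sub>R axis j 1)))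
      (at 0 within {0..1})"
  proof (rule leibniz_rule_field_derivative)
    show "(\<lambda>x. f (x + t *\<^sub>R axis j 1)) integrable_on cbox 0 1" for t
      by (intro integrable_continuous continuous_on_compose2[OF cf] continuous_intros) auto
    show "continuous_on ({0..1} \<times> cbox 0 1) (\<lambda>(t, x). partial j f (x + t *\<^sub>R axis j 1))"
      unfolding split_beta by (intro continuous_on_compose2[OF cont] continuous_intros) auto
  qed (auto intro: has_real_derivative_along_axis diff)
  \<comment> \<open>Translation invariance is available for \<open>t\<close> in
    \<open>{0..1}\<close>, so the two derivatives are compared as one-sided derivatives at
    0.\<close>
  moreover have "(?I has_real_derivative 0) (at 0 within {0..1})"
    by (rule has_field_derivative_transform_within[OF DERIV_const zero_less_one])
      (auto simp: integral_periodic_translate[OF per cf])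
  moreover have "at (0::real) within {0..1} \<noteq> bot"
    by (simp add: trivial_limit_within islimpt_Icc)
  ultimately have "integral (cbox 0 1) (partial j f) = 0"
    by (auto simp: has_real_derivative_iff_has_vector_derivative dest: vector_derivative_unique_within)
  then show ?thesis
    using lebesgue_integral_torus_eq_integral[OF cont] by simp
qed

text \<open>By the product rule, the two integrands add up to a partial derivative of the periodic
  function \<open>f x * g x\<close>, whose integral vanishes.\<close>

lemma integral_by_parts_torus:
  assumes f: "periodic f" "\<And>x. f differentiable (at x)" "continuous_on UNIV (partial j f)"
    and g: "periodic g" "\<And>x. g differentiable (at x)" "continuous_on UNIV (partial j g)"
  shows "(\<integral>x. f x * partial j g x \<partial>torus) = - (\<integral>x. partial j f x * g x \<partial>torus)"
proof -
  have D: "((\<lambda>x. f x * g x) has_derivative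
      (\<lambda>h. f x * frechet_derivative g (at x) h + frechet_derivative f (at x) h * g x)) (at x)" for x
    by (intro has_derivative_mult) (use f g frechet_derivative_works in blast)+
  have P: "partial j (\<lambda>x. f x * g x) = (\<lambda>x. f x * partial j g x + partial j f x * g x)"
    by (rule ext) (simp add: partial_eqI[OF D] partial_def[symmetric])
  note cont = differentiable_imp_continuous_on_UNIV[OF f(2)]
    differentiable_imp_continuous_on_UNIV[OF g(2)]
  have int: "integrable torus (\<lambda>x. f x * partial j g x)" "integrable torus (\<lambda>x. partial j f x * g x)"
    by (intro integrable_torus_continuous continuous_intros cont f g)+
  have "(\<integral>x. partial j (\<lambda>x. f x * g x) x \<partial>torus) = 0"
  proof (rule integral_partial_eq_0)
    show "periodic (\<lambda>x. f x * g x)"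
      using f(1) g(1) by (simp add: periodic_def)
    show "(\<lambda>x. f x * g x) differentiable (at x)" for x
      using D differentiable_def by blast
    show "continuous_on UNIV (partial j (\<lambda>x. f x * g x))"
      unfolding P by (intro continuous_intros cont f g)
  qed
  then show ?thesis
    unfolding P using Bochner_Integration.integral_add[OF int] by simp
qed

section \<open>Classical derivatives as weak derivatives\<close>

lemma test_functionsD:
  assumes "\<phi> \<in> test_functions"
  shows "periodic \<phi>" "\<phi> differentiable (at x)" "continuous_on UNIV (partial j \<phi>)"
proof -
  have "periodic \<phi>" "Ck (Suc 0) \<phi>"
    using assms by (auto simp: test_functions_def simp del: Ck.simps)
  then show "periodic \<phi>" "\<phi> differentiable (at x)" "continuous_on UNIV (partial j \<phi>)"
    by auto
qed

lemma has_weak_gradient_classical: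
  assumes "periodic v" "\<And>i x. (\<lambda>x. v x $ i) differentiable (at x)"
    and "\<And>i j. continuous_on UNIV (partial j (\<lambda>x. v x $ i))"
  shows "has_weak_gradient v (\<lambda>x. \<chi> i j. partial j (\<lambda>x. v x $ i) x)"
  unfolding has_weak_gradient_def
proof (intro ballI allI)
  fix \<phi> :: "real^3 \<Rightarrow> real" and i j :: 3
  assume \<phi>: "\<phi> \<in> test_functions"
  have "periodic (\<lambda>x. v x $ i)"
    using assms(1) by (simp add: periodic_def)
  then show "(\<integral>x. v x $ i * partial j \<phi> x \<partial>torus)
      = - (\<integral>x. (\<chi> i j. partial j (\<lambda>x. v x $ i) x) $ i $ j * \<phi> x \<partial>torus)"
    using integral_by_parts_torus[of "\<lambda>x. v x $ i" j \<phi>] assms test_functionsD[OF \<phi>] by simp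
qed

text \<open>Integration by parts in each component moves the derivatives from the test function to
  \<open>v\<close>, where they sum to the pointwise divergence.\<close>

lemma divergence_free_classical:
  assumes "periodic v" "\<And>i x. (\<lambda>x. v x $ i) differentiable (at x)"
    and "\<And>i j. continuous_on UNIV (partial j (\<lambda>x. v x $ i))"
    and div: "\<And>x. (\<Sum>j\<in>UNIV. partial j (\<lambda>x. v x $ j) x) = 0"
  shows "divergence_free v"
  unfolding divergence_free_def
proof
  fix \<phi> :: "real^3 \<Rightarrow> real"
  assume \<phi>: "\<phi> \<in> test_functions"
  note [continuous_intros] = assms(3) test_functionsD(3)[OF \<phi>]
    differentiable_imp_continuous_on_UNIV[OF assms(2)]
    differentiable_imp_continuous_on_UNIV[OF test_functionsD(2)[OF \<phi>]]
  have "(\<integral>x. (\<Sum>j\<in>UNIV. v x $ j * partial j \<phi> x) \<partial>torus)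
      = (\<Sum>j\<in>UNIV. \<integral>x. v x $ j * partial j \<phi> x \<partial>torus)"
    by (intro Bochner_Integration.integral_sum integrable_torus_continuous continuous_intros)
  also have "\<dots> = - (\<Sum>j\<in>UNIV. \<integral>x. partial j (\<lambda>x. v x $ j) x * \<phi> x \<partial>torus)"
    \<comment> \<open>The diagonal entries \<open>i = j\<close> of the weak gradient
      identity.\<close>
    using has_weak_gradient_classical[OF assms(1-3)] \<phi>
    by (simp add: has_weak_gradient_def sum_negf)
  also have "(\<Sum>j\<in>UNIV. \<integral>x. partial j (\<lambda>x. v x $ j) x * \<phi> x \<partial>torus)
      = (\<integral>x. (\<Sum>j\<in>UNIV. partial j (\<lambda>x. v x $ j) x * \<phi> x) \<partial>torus)"
    by (intro Bochner_Integration.integral_sum[symmetric] integrable_torus_continuous continuous_intros)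
  also have "\<dots> = 0"
    by (simp add: sum_distrib_right[symmetric] div)
  finally show "(\<integral>x. (\<Sum>j\<in>UNIV. v x $ j * partial j \<phi> x) \<partial>torus) = 0" by simp
qed

lemma L2_continuous:
  assumes "periodic f" "continuous_on UNIV f"
  shows "f \<in> L2"
proof -
  have "integrable torus (\<lambda>x. (norm (f x))\<^sup>2)"
    by (intro integrable_torus_continuous continuous_intros assms)
  then show ?thesis
    using assms integrable_torus_continuous[of f] by (auto simp: L2_def)
qed

section \<open>The shear flow as a nonzero element of \<open>V_space\<close>\<close>

definition shear_flow :: "real^3 \<Rightarrow> real^3" where
  "shear_flow x = sin (2 * pi * x $ 2) *\<^sub>R axis 1 1"

text \<open>Reduces periodicity in space to that of a function of one real variable. The codomain is
  arbitrary, so that the flow, its gradient matrix and scalar functions are all covered.\<close>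

lemma periodic_component:
  assumes "\<And>t n. F (t + of_int n) = F t"
  shows "periodic (\<lambda>x. F (x $ j))"
  unfolding periodic_def by (metis Ints_cases assms vector_add_component)

lemma sin_cos_2pi_periodic:
  "sin (2 * pi * (t + of_int n)) = sin (2 * pi * t)"
  "cos (2 * pi * (t + of_int n)) = cos (2 * pi * t)"
  by (simp_all add: distrib_left sin_add cos_add sin_int_2pin cos_int_2pin)

lemma shear_flow_has_derivative:
  "((\<lambda>x. shear_flow x $ i) has_derivative
    (\<lambda>h. if i = 1 then 2 * pi * cos (2 * pi * x $ 2) * h $ 2 else 0)) (at x)"
  unfolding shear_flow_def
  by (cases "i = 1") (auto intro!: derivative_eq_intros bounded_linear_imp_has_derivative
      bounded_linear_vec_nth simp: axis_def)

lemma partial_shear_flow: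
  "partial j (\<lambda>x. shear_flow x $ i)
    = (\<lambda>x. if i = 1 \<and> j = 2 then 2 * pi * cos (2 * pi * x $ 2) else 0)"
  by (rule ext) (auto simp: partial_eqI[OF shear_flow_has_derivative] axis_def)

text \<open>The flow points in direction 1 but varies only in direction 2: its gradient has a single
  nonzero entry, off the diagonal, so the divergence vanishes. Smoothness and periodicity give the
  integrability.\<close>

lemma shear_flow_in_V_space: "shear_flow \<in> V_space"
proof -
  have per: "periodic shear_flow"
    unfolding shear_flow_def by (rule periodic_component) (simp add: sin_cos_2pi_periodic)
  have diff: "(\<lambda>x. shear_flow x $ i) differentiable (at x)" for i x
    using shear_flow_has_derivative differentiable_def by blast
  have cont: "continuous_on UNIV (partial j (\<lambda>x. shear_flow x $ i))" for i j
    unfolding partial_shear_flow by (cases "i = 1 \<and> j = 2") (auto intro!: continuous_intros)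
  have L2: "shear_flow \<in> L2"
    by (rule L2_continuous[OF per]) (unfold shear_flow_def, intro continuous_intros)
  have "(\<lambda>x. \<chi> i j. partial j (\<lambda>x. shear_flow x $ i) x) \<in> L2"
  proof (rule L2_continuous)
    show "periodic (\<lambda>x. \<chi> i j. partial j (\<lambda>x. shear_flow x $ i) x)"
      unfolding partial_shear_flow
      by (rule periodic_component[where j = 2]) (simp add: sin_cos_2pi_periodic cong: if_cong)
    show "continuous_on UNIV (\<lambda>x. \<chi> i j. partial j (\<lambda>x. shear_flow x $ i) x)"
      by (intro continuous_on_vec_lambda cont)
  qed
  then have "shear_flow \<in> H1"
    using has_weak_gradient_classical[OF per diff cont] L2 by (auto simp: H1_def)
  moreover have "divergence_free shear_flow"
    by (rule divergence_free_classical[OF per diff cont]) (simp add: partial_shear_flow sum_3)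
  moreover have "(\<integral>x. shear_flow x \<partial>torus) = 0"
  proof -
    \<comment> \<open>A periodic antiderivative of the sine in direction 2, which makes the zero
      mean an instance of \<open>integral_partial_eq_0\<close>.\<close>
    let ?c = "\<lambda>x::real^3. - cos (2 * pi * x $ 2) / (2 * pi)"
    have D: "(?c has_derivative (\<lambda>h. sin (2 * pi * x $ 2) * h $ 2)) (at x)" for x
      by (auto intro!: derivative_eq_intros bounded_linear_imp_has_derivative bounded_linear_vec_nth)
    have P: "partial 2 ?c = (\<lambda>x. sin (2 * pi * x $ 2))"
      by (rule ext, subst partial_eqI[OF D]) (simp add: axis_def)
    have "(\<integral>x. partial 2 ?c x \<partial>torus) = 0"
    proof (rule integral_partial_eq_0)
      show "periodic ?c"
        by (rule periodic_component) (simp add: sin_cos_2pi_periodic)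
      show "?c differentiable (at x)" for x
        using D differentiable_def by blast
      show "continuous_on UNIV (partial 2 ?c)"
        unfolding P by (intro continuous_intros)
    qed
    moreover have "integrable torus (\<lambda>x. sin (2 * pi * x $ 2))"
      by (intro integrable_torus_continuous continuous_intros)
    ultimately show ?thesis
      unfolding P shear_flow_def by simp
  qed
  ultimately show ?thesis
    using L2 by (simp add: V_space_def H_space_def)
qed

text \<open>A null set containing all points of the cube where the flow is nonzero would contain a
  nonempty open box, which is not negligible.\<close>

lemma shear_flow_nonzero: "\<not> (AE x in torus. shear_flow x = 0)"
proof
  assume "AE x in torus. shear_flow x = 0"
  then have "AE x in lebesgue. x \<in> cbox 0 1 \<longrightarrow> shear_flow x = 0"
    unfolding torus_def by (subst (asm) AE_restrict_space_iff) auto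
  then obtain N where N: "N \<in> null_sets lebesgue" "{x. \<not> (x \<in> cbox 0 1 \<longrightarrow> shear_flow x = 0)} \<subseteq> N"
    unfolding eventually_ae_filter by auto
  \<comment> \<open>On this box \<open>2 * pi * x $ 2\<close> lies strictly between 0 and
    \<open>pi\<close>, so the sine is positive.\<close>
  let ?B = "box 0 (\<chi> i. 1 / 2) :: (real^3) set"
  have "?B \<subseteq> N"
  proof
    fix x assume "x \<in> ?B"
    then have x: "0 < x $ i" "x $ i < 1 / 2" for i
      by (auto simp: mem_box_cart)
    have "sin (2 * pi * x $ 2) > 0"
      using x[of 2] by (intro sin_gt_zero) (auto simp: field_simps)
    then have "shear_flow x \<noteq> 0"
      by (simp add: shear_flow_def)
    moreover have "x \<in> cbox 0 1"
    proof -
      have "0 \<le> x $ i \<and> x $ i \<le> 1" for i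
        using x[of i] by simp
      then show ?thesis
        by (simp add: mem_box_cart)
    qed
    ultimately show "x \<in> N" using N(2) by auto
  qed
  then have "negligible ?B"
    using N(1) negligible_iff_null_sets negligible_subset by blast
  moreover have "?B \<noteq> {}"
    by (auto simp: box_ne_empty inner_axis Basis_vec_def)
  ultimately show False
    using open_not_negligible open_box by blast
qed

section \<open>The Rayleigh quotient and its infimum\<close>

lemma L2_norm_squared: "(L2_norm f)\<^sup>2 = (\<integral>x. (norm (f x))\<^sup>2 \<partial>torus)"
  by (simp add: L2_norm_def)

text \<open>Shows that the quotients defining \<open>alpha\<close> have positive denominators,
  although "nonzero" is meant up to null sets.\<close>

lemma L2_norm_squared_eq_0_iff:
  assumes "f \<in> L2"
  shows "(L2_norm f)\<^sup>2 = 0 \<longleftrightarrow> (AE x in torus. f x = 0)"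
  using assms integral_nonneg_eq_0_iff_AE[of torus "\<lambda>x. (norm (f x))\<^sup>2"]
  by (simp add: L2_norm_squared L2_def)

lemma energy_nonneg: "0 \<le> \<nu> \<Longrightarrow> 0 \<le> K \<Longrightarrow> 0 \<le> energy \<nu> \<chi>\<^sub>\<omega> K v"
  by (simp add: energy_def)

text \<open>A field that vanishes almost everywhere is no competitor in the infimum, but then the
  left side is 0 and the energy is nonnegative. Otherwise the infimum is at most the quotient of
  \<open>v\<close>, and the positive denominator is cleared.\<close>

lemma alpha_energy_bound:
  assumes "0 \<le> \<nu>" "0 \<le> K" "v \<in> V_space"
  shows "alpha \<nu> \<chi>\<^sub>\<omega> K * (L2_norm v)\<^sup>2 \<le> energy \<nu> \<chi>\<^sub>\<omega> K v"
proof (cases "AE x in torus. v x = 0")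
  case True
  then have "(L2_norm v)\<^sup>2 = 0"
    using assms(3) L2_norm_squared_eq_0_iff by (auto simp: V_space_def H_space_def)
  then show ?thesis using energy_nonneg[OF assms(1,2)] by simp
next
  case False
  then have pos: "(L2_norm v)\<^sup>2 > 0"
    using assms(3) L2_norm_squared_eq_0_iff[of v]
    by (auto simp: V_space_def H_space_def)
  have "alpha \<nu> \<chi>\<^sub>\<omega> K \<le> energy \<nu> \<chi>\<^sub>\<omega> K v / (L2_norm v)\<^sup>2"
    unfolding alpha_def
  proof (rule cINF_lower)
    \<comment> \<open>Without a lower bound, a real infimum need not lie below the members of its
      set.\<close>
    show "bdd_below ((\<lambda>v. energy \<nu> \<chi>\<^sub>\<omega> K v / (L2_norm v)\<^sup>2) ` {v \<in> V_space. \<not> (AE x in torus. v x = 0)})"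
      by (rule bdd_belowI2[where m = 0]) (simp add: energy_nonneg assms)
  qed (use assms False in simp)
  then show ?thesis using pos by (simp add: pos_le_divide_eq)
qed

text \<open>Dividing by the positive squared norm turns \<open>a\<close> into a lower bound of all
  Rayleigh quotients.\<close>

lemma alpha_greatest:
  assumes bound: "\<And>v. v \<in> V_space \<Longrightarrow> a * (L2_norm v)\<^sup>2 \<le> energy \<nu> \<chi>\<^sub>\<omega> K v"
  shows "a \<le> alpha \<nu> \<chi>\<^sub>\<omega> K"
  unfolding alpha_def
proof (rule cINF_greatest)
  show "{v \<in> V_space. \<not> (AE x in torus. v x = 0)} \<noteq> {}"
    using shear_flow_in_V_space shear_flow_nonzero by blast
next
  fix v assume v: "v \<in> {v \<in> V_space. \<not> (AE x in torus. v x = 0)}"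
  then have "(L2_norm v)\<^sup>2 > 0"
    using L2_norm_squared_eq_0_iff[of v] by (auto simp: V_space_def H_space_def)
  then show "a \<le> energy \<nu> \<chi>\<^sub>\<omega> K v / (L2_norm v)\<^sup>2"
    using bound v by (simp add: pos_le_divide_eq)
qed

theorem proposition2p2:
  fixes \<nu> K\<^sub>m\<^sub>i\<^sub>n :: real and \<chi>\<^sub>\<omega> :: "real^3 \<Rightarrow> real"
  assumes "\<nu> > 0"
    and "\<chi>\<^sub>\<omega> \<in> Linfty"
    and "AE x in torus. \<chi>\<^sub>\<omega> x \<ge> 0"
    and "K\<^sub>m\<^sub>i\<^sub>n \<ge> 0"
  shows "(\<forall>v\<in>V_space. energy \<nu> \<chi>\<^sub>\<omega> K\<^sub>m\<^sub>i\<^sub>n v \<ge> alpha \<nu> \<chi>\<^sub>\<omega> K\<^sub>m\<^sub>i\<^sub>n * (L2_norm v)\<^sup>2) \<and>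
    (alpha \<nu> \<chi>\<^sub>\<omega> K\<^sub>m\<^sub>i\<^sub>n > 0 \<longleftrightarrow>
      (\<exists>\<alpha>>0. \<forall>v\<in>V_space. energy \<nu> \<chi>\<^sub>\<omega> K\<^sub>m\<^sub>i\<^sub>n v \<ge> \<alpha> * (L2_norm v)\<^sup>2)) \<and>
    (alpha \<nu> \<chi>\<^sub>\<omega> K\<^sub>m\<^sub>i\<^sub>n > 0 \<longrightarrow>
      (\<forall>v\<in>V_space. energy \<nu> \<chi>\<^sub>\<omega> K\<^sub>m\<^sub>i\<^sub>n v \<ge> alpha \<nu> \<chi>\<^sub>\<omega> K\<^sub>m\<^sub>i\<^sub>n * (L2_norm v)\<^sup>2) \<and>
      (\<forall>\<alpha>. (\<forall>v\<in>V_space. energy \<nu> \<chi>\<^sub>\<omega> K\<^sub>m\<^sub>i\<^sub>n v \<ge> \<alpha> * (L2_norm v)\<^sup>2) \<longrightarrow>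
        \<alpha> \<le> alpha \<nu> \<chi>\<^sub>\<omega> K\<^sub>m\<^sub>i\<^sub>n))"
proof -
  have bound: "\<forall>v\<in>V_space. energy \<nu> \<chi>\<^sub>\<omega> K\<^sub>m\<^sub>i\<^sub>n v \<ge> alpha \<nu> \<chi>\<^sub>\<omega> K\<^sub>m\<^sub>i\<^sub>n * (L2_norm v)\<^sup>2"
    using alpha_energy_bound assms(1,4) by (simp add: less_imp_le)
  have greatest: "\<alpha> \<le> alpha \<nu> \<chi>\<^sub>\<omega> K\<^sub>m\<^sub>i\<^sub>n"
    if "\<forall>v\<in>V_space. energy \<nu> \<chi>\<^sub>\<omega> K\<^sub>m\<^sub>i\<^sub>n v \<ge> \<alpha> * (L2_norm v)\<^sup>2" for \<alpha>
    using that by (intro alpha_greatest) blast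
  show ?thesis
    \<comment> \<open>In the equivalence, \<open>alpha\<close> itself is the witness for one
      direction; conversely, a positive admissible constant lies below \<open>alpha\<close> and
      forces it to be positive.\<close>
    using bound greatest by (meson less_le_trans)
qed

end
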